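(* Let $(X_t)_{t\in\mathbb{Z}}$ be the stationary real-valued autoregressive process of order $p$ described in the context. Let $\epsilon>0$ be such that $\rho_\epsilon=(1+\epsilon)/\rho<1$, and let $K_\epsilon<\infty$ be a constant with $|\alpha_k|\le K_\epsilon\rho_\epsilon^k$ for all $k\in\mathbb{N}$. Let $s_1\le\cdots\le s_k\le t_1\le\cdots\le t_l$ be arbitrary integers and let $g:\mathbb{R}^k\to\mathbb{R}$ and $h:\mathbb{R}^l\to\mathbb{R}$ be measurable functions. If $g$ is bounded and $\mathbb{E}|h(X_{t_1},\ldots,X_{t_l})|<\infty$, then $$\left|\mathrm{cov}\left(g(X_{s_1},\ldots,X_{s_k}),\,h(X_{t_1},\ldots,X_{t_l})\right)\right|\le \|g\|_\infty\,\mathrm{Lip}\,h\;K_1\;l\;\rho_\epsilon^{\,t_1-s_k},$$ where $K_1=2\,\frac{1}{1-\rho_\epsilon}\,K_\epsilon\,\mathbb{E}|\varepsilon_0|$.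
   Context: For $h:\mathbb{R}^l\to\mathbb{R}$, $\mathrm{Lip}\,h=\sup_{x\ne y}|h(x)-h(y)|/\|x-y\|_{l_1}\in[0,\infty]$, where $\|(z_1,\ldots,z_l)\|_{l_1}=\sum_i|z_i|$; $\|g\|_\infty=\sup_x|g(x)|$. The process $(X_t)_{t\in\mathbb{Z}}$ is the stationary solution of $X_t=\theta_1X_{t-1}+\cdots+\theta_pX_{t-p}+\varepsilon_t$, $t\in\mathbb{Z}$, where $(\varepsilon_t)_{t\in\mathbb{Z}}$ are independent and identically distributed real random variables with $\mathbb{E}\varepsilon_t=0$ (in particular $\mathbb{E}|\varepsilon_0|<\infty$), and the characteristic polynomial $\theta(z)=1-\theta_1z-\cdots-\theta_pz^p$ has no zero in the closed unit disc $\{|z|\le1\}$. The process has the causal linear representation $X_t=\sum_{k=0}^\infty\alpha_k\varepsilon_{t-k}$, where $\alpha_0=1$ and $\alpha_k=\sum_{j\le k}\sum_{k_1+\cdots+k_j=k}\theta_{k_1}\cdots\theta_{k_j}$ (indices $k_i\in\{1,\ldots,p\}$). Denote by $\xi_1,\ldots,\xi_p$ the (complex) roots of $\theta$ and let $\rho=\min\{|\xi_1|,\ldots,|\xi_p|\}>1$. For every $\epsilon>0$, with $\rho_\epsilon=(1+\epsilon)/\rho$, there exists $K_\epsilon<\infty$ such that $|\alpha_k|\le K_\epsilon\rho_\epsilon^k$ for all $k\in\mathbb{N}$. *)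

theory Defs
  imports "HOL-Probability.Probability" "HOL-Computational_Algebra.Polynomial"
begin

text \<open>
  A point of \<open>\<real>\<^sup>n\<close> is an extensional function on the index set \<open>{1..n}\<close>. This set is
  the carrier of the product sigma-algebra \<open>\<Pi>\<^sub>M i\<in>{1..n}. borel\<close>, which is the Borel
  sigma-algebra of \<open>\<real>\<^sup>n\<close>.
\<close>

abbreviation Rn :: "nat \<Rightarrow> (nat \<Rightarrow> real) set" where
  "Rn n \<equiv> {1..n} \<rightarrow>\<^sub>E UNIV"

abbreviation borel_Rn :: "nat \<Rightarrow> (nat \<Rightarrow> real) measure" where
  "borel_Rn n \<equiv> \<Pi>\<^sub>M i\<in>{1..n}. borel"

definition sup_norm :: "nat \<Rightarrow> ((nat \<Rightarrow> real) \<Rightarrow> real) \<Rightarrow> ennreal" where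
  "sup_norm n g = (SUP x\<in>Rn n. ennreal \<bar>g x\<bar>)"

definition l1_norm :: "nat \<Rightarrow> (nat \<Rightarrow> real) \<Rightarrow> real" where
  "l1_norm n z = (\<Sum>i=1..n. \<bar>z i\<bar>)"

definition Lip :: "nat \<Rightarrow> ((nat \<Rightarrow> real) \<Rightarrow> real) \<Rightarrow> ennreal" where
  "Lip n h = (SUP (x, y) \<in> {(x, y). x \<in> Rn n \<and> y \<in> Rn n \<and> x \<noteq> y}.
                ennreal (\<bar>h x - h y\<bar> / l1_norm n (\<lambda>i. x i - y i)))"

definition cov :: "'a measure \<Rightarrow> ('a \<Rightarrow> real) \<Rightarrow> ('a \<Rightarrow> real) \<Rightarrow> real" where
  "cov M U V =
     (\<integral>\<omega>. (U \<omega> - (\<integral>\<omega>'. U \<omega>' \<partial>M)) * (V \<omega> - (\<integral>\<omega>'. V \<omega>' \<partial>M)) \<partial>M)"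

text \<open>
  Stationarity is meant in the strict sense: all finite-dimensional distributions are
  invariant under time shifts. (No second moments are assumed, so the weak sense is not
  available.)
\<close>

definition strictly_stationary :: "'a measure \<Rightarrow> (int \<Rightarrow> 'a \<Rightarrow> real) \<Rightarrow> bool" where
  "strictly_stationary M X \<longleftrightarrow>
     (\<forall>t. X t \<in> borel_measurable M) \<and>
     (\<forall>J u. finite J \<longrightarrow>
        distr M (\<Pi>\<^sub>M j\<in>J. borel) (\<lambda>\<omega>. \<lambda>j\<in>J. X (j + u) \<omega>) =
        distr M (\<Pi>\<^sub>M j\<in>J. borel) (\<lambda>\<omega>. \<lambda>j\<in>J. X j \<omega>))"

definition iid :: "'a measure \<Rightarrow> (int \<Rightarrow> 'a \<Rightarrow> real) \<Rightarrow> bool" where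
  "iid M e \<longleftrightarrow>
     prob_space.indep_vars M (\<lambda>_. borel) e UNIV \<and>
     (\<forall>t. distr M borel (e t) = distr M borel (e 0))"

text \<open>
  The equation is required almost surely for each time point. The coefficients are
  \<open>\<theta> 1, \<dots>, \<theta> p\<close>; other values of \<open>\<theta>\<close> are irrelevant.
\<close>

definition ar_stationary_solution ::
  "'a measure \<Rightarrow> nat \<Rightarrow> (nat \<Rightarrow> real) \<Rightarrow> (int \<Rightarrow> 'a \<Rightarrow> real) \<Rightarrow> (int \<Rightarrow> 'a \<Rightarrow> real) \<Rightarrow> bool" where
  "ar_stationary_solution M p \<theta> e X \<longleftrightarrow>
     strictly_stationary M X \<and>
     (\<forall>t. AE \<omega> in M. X t \<omega> = (\<Sum>j=1..p. \<theta> j * X (t - int j) \<omega>) + e t \<omega>)"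

definition ar_poly :: "nat \<Rightarrow> (nat \<Rightarrow> real) \<Rightarrow> complex poly" where
  "ar_poly p \<theta> = 1 - (\<Sum>j=1..p. monom (complex_of_real (\<theta> j)) j)"

definition ar_rho :: "nat \<Rightarrow> (nat \<Rightarrow> real) \<Rightarrow> real" where
  "ar_rho p \<theta> = Min (cmod ` {z. poly (ar_poly p \<theta>) z = 0})"

text \<open>The list \<open>ks\<close> is the tuple \<open>(k\<^sub>1, \<dots>, k\<^sub>j)\<close>; the empty tuple gives \<open>\<alpha>\<^sub>0 = 1\<close>.\<close>

definition ar_alpha :: "nat \<Rightarrow> (nat \<Rightarrow> real) \<Rightarrow> nat \<Rightarrow> real" where
  "ar_alpha p \<theta> k =
     (\<Sum>j\<le>k. \<Sum>ks | length ks = j \<and> set ks \<subseteq> {1..p} \<and> sum_list ks = k.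
        prod_list (map \<theta> ks))"

end

theory Submission
  imports Defs "HOL-Computational_Algebra.Fundamental_Theorem_Algebra"
begin

text \<open>
  Iterating the autoregressive equation \<open>n\<close> times writes \<open>X\<^sub>t\<close> as
  \<open>\<Sum>k<n. \<alpha>\<^sub>k \<epsilon>\<^bsub>t-k\<^esub>\<close> plus a combination of \<open>X\<^bsub>t-n\<^esub>, \<dots>, X\<^bsub>t-n-p+1\<^esub>\<close> whose coefficients
  tend to \<open>0\<close>; by stationarity this remainder vanishes in probability, which gives the causal
  representation \<open>X\<^sub>t = \<Sum>k. \<alpha>\<^sub>k \<epsilon>\<^bsub>t-k\<^esub>\<close>. Splitting the noise at time \<open>s\<^sub>k\<close>, the
  covariance equals \<open>E (g(U) (h(F + P) - h(F + P')))\<close>, where \<open>(U, P)\<close> depends on the past,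
  \<open>F\<close> on the independent future, and \<open>P'\<close> is an independent copy of \<open>P\<close>. The Lipschitz bound
  and \<open>E \<bar>P\<^sub>i\<bar> \<le> E \<bar>\<epsilon>\<^sub>0\<bar> (\<Sum>q\<ge>t\<^sub>i-s\<^sub>k. \<bar>\<alpha>\<^sub>q\<bar>)\<close> finish the proof.
\<close>

section \<open>The coefficients \<open>ar_alpha\<close> as sums over compositions of an
  integer\<close>

lemma length_le_sum_list:
  fixes ks :: "nat list"
  assumes "set ks \<subseteq> {1..p}"
  shows "length ks \<le> sum_list ks"
  using assms by (induction ks) auto

lemma finite_compositions:
  "finite {ks :: nat list. set ks \<subseteq> {1..p} \<and> sum_list ks = n}"
proof (rule finite_subset)
  show "{ks. set ks \<subseteq> {1..p} \<and> sum_list ks = n} \<subseteq> {ks. set ks \<subseteq> {1..p} \<and> length ks \<le> n}"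
    by (auto simp del: One_nat_def dest: length_le_sum_list)
qed (rule finite_lists_length_le, simp)

text \<open>Since all parts are at least 1, a composition of \<open>n\<close> has at most
  \<open>n\<close> parts. The outer sum over \<open>j\<close> therefore only groups the finitely
  many compositions by length.\<close>

lemma ar_alpha_alt:
  "ar_alpha p \<theta> n = (\<Sum>ks | set ks \<subseteq> {1..p} \<and> sum_list ks = n. prod_list (map \<theta> ks))"
proof -
  let ?S = "{ks. set ks \<subseteq> {1..p} \<and> sum_list ks = n}"
  have "ar_alpha p \<theta> n = (\<Sum>j\<le>n. \<Sum>ks | ks \<in> ?S \<and> length ks = j. prod_list (map \<theta> ks))"
    unfolding ar_alpha_def by (intro sum.cong refl) auto
  also have "\<dots> = (\<Sum>ks\<in>?S. prod_list (map \<theta> ks))"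
    by (rule sum.group[OF finite_compositions]) (use length_le_sum_list in blast)+
  finally show ?thesis .
qed

text \<open>Removing the first part \<open>j\<close> of a nonempty composition of \<open>n\<close>
  leaves a composition of \<open>n - j\<close>, and \<open>j\<close> together with the rest
  determines the original. The empty composition contributes the 1 at \<open>n = 0\<close>. The
  guard \<open>j \<le> n\<close> excludes truncated subtraction.\<close>

lemma ar_alpha_rec:
  "ar_alpha p \<theta> n =
     (if n = 0 then 1 else 0) + (\<Sum>j=1..p. if j \<le> n then \<theta> j * ar_alpha p \<theta> (n - j) else 0)"
proof (cases "n = 0")
  case True
  have "{ks :: nat list. set ks \<subseteq> {1..p} \<and> sum_list ks = 0} = {[]}"
  proof safe
    fix ks :: "nat list" assume "set ks \<subseteq> {1..p}" "sum_list ks = 0"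
    then show "ks = []" by (cases ks) auto
  qed auto
  then have "ar_alpha p \<theta> 0 = 1" by (simp add: ar_alpha_alt)
  then show ?thesis using True by simp
next
  case False
  define S where "S = (\<lambda>n. {ks :: nat list. set ks \<subseteq> {1..p} \<and> sum_list ks = n})"
  have fin: "finite (S m)" for m
    unfolding S_def by (rule finite_compositions)
  have al: "ar_alpha p \<theta> m = (\<Sum>ks\<in>S m. prod_list (map \<theta> ks))" for m
    unfolding S_def by (rule ar_alpha_alt)
  have dec: "S n = (\<Union>j\<in>{j\<in>{1..p}. j \<le> n}. (#) j ` S (n - j))"
  proof (intro subset_antisym subsetI)
    fix ks assume ks: "ks \<in> S n"
    with False obtain j js where "ks = j # js" by (cases ks) (auto simp: S_def)
    with ks show "ks \<in> (\<Union>j\<in>{j\<in>{1..p}. j \<le> n}. (#) j ` S (n - j))"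
      by (auto simp: S_def intro!: bexI[of _ j])
  qed (auto simp: S_def)
  have "ar_alpha p \<theta> n = (\<Sum>j\<in>{j\<in>{1..p}. j \<le> n}. \<Sum>ks\<in>(#) j ` S (n - j). prod_list (map \<theta> ks))"
    unfolding al[of n] dec by (rule sum.UNION_disjoint) (auto simp: fin)
  also have "\<dots> = (\<Sum>j\<in>{j\<in>{1..p}. j \<le> n}. \<theta> j * ar_alpha p \<theta> (n - j))"
    by (intro sum.cong refl) (simp add: sum.reindex al sum_distrib_left)
  also have "\<dots> = (\<Sum>j=1..p. if j \<le> n then \<theta> j * ar_alpha p \<theta> (n - j) else 0)"
    by (rule sum.inter_filter) simp
  finally show ?thesis using False by simp
qed

section \<open>Iteration of the autoregressive equation\<close>

text \<open>
  \<open>ar_remainder p \<theta> n i\<close> is the coefficient of \<open>X\<^bsub>t-n-i\<^esub>\<close>, \<open>i < p\<close>, after \<open>n\<close> substitutions. The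
  closed form is that of the recursion for \<open>\<alpha>\<^bsub>n+i\<^esub>\<close> with the terms \<open>j \<le> i\<close> left out.
\<close>

definition ar_remainder :: "nat \<Rightarrow> (nat \<Rightarrow> real) \<Rightarrow> nat \<Rightarrow> nat \<Rightarrow> real" where
  "ar_remainder p \<theta> n i = (if n = 0 \<and> i = 0 then 1 else 0) +
     (\<Sum>j=1..p. if i < j \<and> j \<le> n + i then \<theta> j * ar_alpha p \<theta> (n + i - j) else 0)"

text \<open>For \<open>i = 0\<close> the guard \<open>i < j\<close> always holds, so nothing is left
  out of the recursion. Hence the next substitution, which replaces X_{t-n}, releases exactly
  \<open>ar_alpha p \<theta> n\<close> times the noise at time t-n.\<close>

lemma ar_remainder_0: "ar_remainder p \<theta> n 0 = ar_alpha p \<theta> n"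
proof -
  have "(\<Sum>j=1..p. if 0 < j \<and> j \<le> n then \<theta> j * ar_alpha p \<theta> (n - j) else 0) =
      (\<Sum>j=1..p. if j \<le> n then \<theta> j * ar_alpha p \<theta> (n - j) else 0)"
    by (intro sum.cong) auto
  then show ?thesis
    using ar_alpha_rec[of p \<theta> n] unfolding ar_remainder_def by (simp cong: if_cong)
qed

text \<open>Substituting for X_{t-n}, whose weight is alpha_n, adds alpha_n times
  \<open>\<theta> (Suc i)\<close> to the weight that X_{t-n-1-i} already had. In the closed form
  this is the summand \<open>j = Suc i\<close> being split off.\<close>

lemma ar_remainder_Suc:
  assumes "i < p"
  shows "ar_remainder p \<theta> (Suc n) i = ar_remainder p \<theta> n (Suc i) + ar_alpha p \<theta> n * \<theta> (Suc i)"
proof -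
  let ?f = "\<lambda>j. ar_alpha p \<theta> (Suc (n + i) - j) * \<theta> j"
  have "(\<Sum>j=1..p. if i < j \<and> j \<le> Suc (n + i) then ?f j else 0) =
      (\<Sum>j=1..p. (if Suc i < j \<and> j \<le> Suc (n + i) then ?f j else 0) + (if j = Suc i then ?f j else 0))"
    by (intro sum.cong) auto
  also have "\<dots> = (\<Sum>j=1..p. if Suc i < j \<and> j \<le> Suc (n + i) then ?f j else 0) + ?f (Suc i)"
    using assms by (simp add: sum.distrib)
  finally show ?thesis
    by (simp add: ar_remainder_def mult.commute cong: if_cong)
qed

text \<open>A purely algebraic identity, to be applied pathwise with \<open>x k\<close> = X_{t-k};
  the inner difference is then the noise at time t-k.\<close>

lemma ar_iterate:
  fixes x :: "nat \<Rightarrow> real"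
  assumes "p \<ge> 1"
  shows "(\<Sum>k<n. ar_alpha p \<theta> k * (x k - (\<Sum>j=1..p. \<theta> j * x (k + j)))) +
     (\<Sum>i<p. ar_remainder p \<theta> n i * x (n + i)) = x 0"
proof (induction n)
  case 0
  have "(\<Sum>i<p. ar_remainder p \<theta> 0 i * x i) = (\<Sum>i<p. if i = 0 then x 0 else 0)"
  proof (intro sum.cong refl)
    fix i
    have "(\<Sum>j=1..p. if i < j \<and> j \<le> 0 + i then \<theta> j * ar_alpha p \<theta> (0 + i - j) else 0) = 0"
      by (intro sum.neutral) auto
    then show "ar_remainder p \<theta> 0 i * x i = (if i = 0 then x 0 else 0)"
      unfolding ar_remainder_def by simp
  qed
  then show ?case using assms by simp
next
  case (Suc n)
  obtain q where q: "p = Suc q" using assms by (cases p) auto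
  \<comment> \<open>No \<open>j \<le> p\<close> exceeds \<open>p\<close>, and
    \<open>p \<ge> 1\<close> removes the initial 1. So the shifted sum may be extended to index
    \<open>p\<close> at no cost.\<close>
  have last0: "ar_remainder p \<theta> n p = 0"
  proof -
    have "(\<Sum>j=1..p. if p < j \<and> j \<le> n + p then \<theta> j * ar_alpha p \<theta> (n + p - j) else 0) = 0"
      by (intro sum.neutral) auto
    then show ?thesis
      unfolding ar_remainder_def using assms by simp
  qed
  have "(\<Sum>i<p. ar_remainder p \<theta> (Suc n) i * x (Suc n + i)) =
      (\<Sum>i<p. ar_remainder p \<theta> n (Suc i) * x (n + Suc i)) +
      (\<Sum>i<p. ar_alpha p \<theta> n * (\<theta> (Suc i) * x (n + Suc i)))"
    unfolding sum.distrib[symmetric]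
    by (intro sum.cong) (simp_all add: ar_remainder_Suc algebra_simps)
  also have "(\<Sum>i<p. ar_remainder p \<theta> n (Suc i) * x (n + Suc i)) =
      (\<Sum>i<Suc p. ar_remainder p \<theta> n i * x (n + i)) - ar_remainder p \<theta> n 0 * x n"
    by (subst sum.lessThan_Suc_shift) simp
  also have "(\<Sum>i<Suc p. ar_remainder p \<theta> n i * x (n + i)) = (\<Sum>i<p. ar_remainder p \<theta> n i * x (n + i))"
    by (simp add: last0)
  also have "(\<Sum>i<p. ar_alpha p \<theta> n * (\<theta> (Suc i) * x (n + Suc i))) =
      ar_alpha p \<theta> n * (\<Sum>j=1..p. \<theta> j * x (n + j))"
    unfolding sum_distrib_left[symmetric]
    by (rule arg_cong[where f="(*) _"]) (rule sum.reindex_bij_witness[of _ "\<lambda>j. j - 1" Suc], auto)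
  finally show ?case
    using Suc.IH by (simp add: ar_remainder_0 algebra_simps)
qed

text \<open>For fixed \<open>i\<close> the remainder is a sum of at most \<open>p\<close>
  index-shifted copies of \<open>ar_alpha\<close> with constant weights, apart from a term present
  only at \<open>n = 0\<close>.\<close>

lemma ar_remainder_tendsto_0:
  assumes "ar_alpha p \<theta> \<longlonglongrightarrow> 0"
  shows "(\<lambda>n. ar_remainder p \<theta> n i) \<longlonglongrightarrow> 0"
proof -
  have "(\<lambda>n. if i < j \<and> j \<le> n + i then \<theta> j * ar_alpha p \<theta> (n + i - j) else 0) \<longlonglongrightarrow> 0" for j
  proof (rule Lim_null_comparison)
    have "(\<lambda>n. ar_alpha p \<theta> (n + i - j)) \<longlonglongrightarrow> 0"
      by (rule filterlim_compose[OF assms], rule filterlim_at_top_mono[OF filterlim_minus_const_nat_at_top[of j]])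
        (simp add: diff_le_mono)
    then show "(\<lambda>n. \<bar>\<theta> j * ar_alpha p \<theta> (n + i - j)\<bar>) \<longlonglongrightarrow> 0"
      by (intro tendsto_rabs_zero tendsto_mult_right_zero)
  qed auto
  then have "(\<lambda>n. \<Sum>j=1..p. if i < j \<and> j \<le> n + i then \<theta> j * ar_alpha p \<theta> (n + i - j) else 0) \<longlonglongrightarrow> 0"
    by (intro tendsto_null_sum) auto
  moreover have "(\<lambda>n. if n = 0 \<and> i = 0 then 1 else (0::real)) \<longlonglongrightarrow> 0"
    by (rule tendsto_eventually) (auto intro: eventually_mono[OF eventually_gt_at_top[of 0]])
  ultimately show ?thesis
    unfolding ar_remainder_def by (rule tendsto_add_zero[rotated])
qed

section \<open>Linear series with summable coefficients and a common first absolute moment\<close>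

text \<open>By Tonelli, the expectation of the series of absolute values is \<open>m\<close> times
  the sum of the \<open>\<bar>a k\<bar>\<close>, hence finite. All three claims follow from
  this.\<close>

lemma
  fixes u :: "nat \<Rightarrow> 'a \<Rightarrow> real"
  assumes u: "\<And>k. integrable M (u k)" and m: "\<And>k. (\<integral>\<omega>. \<bar>u k \<omega>\<bar> \<partial>M) = m"
    and a: "summable (\<lambda>k. \<bar>a k\<bar>)"
  shows AE_summable_linear_series: "AE \<omega> in M. summable (\<lambda>k. \<bar>a k * u k \<omega>\<bar>)"
    and integrable_linear_series: "integrable M (\<lambda>\<omega>. \<Sum>k. a k * u k \<omega>)"
    and integral_abs_linear_series_le: "(\<integral>\<omega>. \<bar>\<Sum>k. a k * u k \<omega>\<bar> \<partial>M) \<le> (\<Sum>k. \<bar>a k\<bar>) * m"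
proof -
  have [measurable]: "u k \<in> borel_measurable M" for k using u by auto
  have int: "(\<integral>\<omega>. \<bar>a k * u k \<omega>\<bar> \<partial>M) = \<bar>a k\<bar> * m" for k
    by (simp add: abs_mult m)
  have m0: "0 \<le> m" unfolding m[of 0, symmetric] by simp
  have am: "summable (\<lambda>k. \<bar>a k\<bar> * m)" using a by (rule summable_mult2)
  have "(\<integral>\<^sup>+\<omega>. (\<Sum>k. ennreal \<bar>a k * u k \<omega>\<bar>) \<partial>M) = (\<Sum>k. \<integral>\<^sup>+\<omega>. ennreal \<bar>a k * u k \<omega>\<bar> \<partial>M)"
    by (rule nn_integral_suminf) simp
  also have "\<dots> = (\<Sum>k. ennreal (\<bar>a k\<bar> * m))"
    by (subst nn_integral_eq_integral) (simp_all add: int u)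
  also have "\<dots> < \<infinity>"
    using am m0 by (simp add: suminf_ennreal2 less_top[symmetric])
  finally have "AE \<omega> in M. (\<Sum>k. ennreal \<bar>a k * u k \<omega>\<bar>) \<noteq> \<infinity>"
    by (intro nn_integral_noteq_infinite) auto
  then show S: "AE \<omega> in M. summable (\<lambda>k. \<bar>a k * u k \<omega>\<bar>)"
    by eventually_elim (rule summable_suminf_not_top, auto)
  have i: "integrable M (\<lambda>\<omega>. a k * u k \<omega>)" for k using u by simp
  have S': "AE \<omega> in M. summable (\<lambda>k. norm (a k * u k \<omega>))" using S by simp
  have am': "summable (\<lambda>k. \<integral>\<omega>. norm (a k * u k \<omega>) \<partial>M)" using am by (simp only: real_norm_def int)
  show "integrable M (\<lambda>\<omega>. \<Sum>k. a k * u k \<omega>)"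
    by (rule integrable_suminf[OF i S' am'])
  have iabs: "integrable M (\<lambda>\<omega>. \<Sum>k. \<bar>a k * u k \<omega>\<bar>)"
    by (rule integrable_suminf) (use u S am int in simp_all)
  have "(\<integral>\<omega>. \<bar>\<Sum>k. a k * u k \<omega>\<bar> \<partial>M) \<le> (\<integral>\<omega>. (\<Sum>k. \<bar>a k * u k \<omega>\<bar>) \<partial>M)"
  proof (rule integral_mono_AE[OF _ iabs])
    show "integrable M (\<lambda>\<omega>. \<bar>\<Sum>k. a k * u k \<omega>\<bar>)"
      using integrable_suminf[OF i S' am'] by (rule integrable_abs)
    show "AE \<omega> in M. \<bar>\<Sum>k. a k * u k \<omega>\<bar> \<le> (\<Sum>k. \<bar>a k * u k \<omega>\<bar>)"
      using S by eventually_elim (rule summable_rabs)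
  qed
  also have "\<dots> = (\<Sum>k. \<bar>a k\<bar> * m)"
    by (subst integral_suminf) (use u S am int in simp_all)
  also have "\<dots> = (\<Sum>k. \<bar>a k\<bar>) * m"
    using a by (rule suminf_mult2[symmetric])
  finally show "(\<integral>\<omega>. \<bar>\<Sum>k. a k * u k \<omega>\<bar> \<partial>M) \<le> (\<Sum>k. \<bar>a k\<bar>) * m" .
qed

section \<open>The causal linear representation\<close>

lemma strictly_stationary_integral:
  fixes f :: "real \<Rightarrow> real"
  assumes X: "strictly_stationary M X" and [measurable]: "f \<in> borel_measurable borel"
  shows "(\<integral>\<omega>. f (X t \<omega>) \<partial>M) = (\<integral>\<omega>. f (X 0 \<omega>) \<partial>M)"
proof -
  have [measurable]: "X t \<in> borel_measurable M" for t
    using X by (simp add: strictly_stationary_def)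
  have eq: "distr M (\<Pi>\<^sub>M j\<in>{0::int}. borel) (\<lambda>\<omega>. \<lambda>j\<in>{0}. X (j + t) \<omega>) =
      distr M (\<Pi>\<^sub>M j\<in>{0}. borel) (\<lambda>\<omega>. \<lambda>j\<in>{0}. X j \<omega>)"
    using X unfolding strictly_stationary_def by blast
  have "(\<integral>\<omega>. f (X t \<omega>) \<partial>M) =
      (\<integral>x. f (x 0) \<partial>distr M (\<Pi>\<^sub>M j\<in>{0::int}. borel) (\<lambda>\<omega>. \<lambda>j\<in>{0}. X (j + t) \<omega>))"
    by (subst integral_distr) auto
  also have "\<dots> = (\<integral>\<omega>. f (X 0 \<omega>) \<partial>M)"
    unfolding eq by (subst integral_distr) auto
  finally show ?thesis .
qed

text \<open>Subadditivity of truncation at 1, which bounds the remainder term by term without a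
  moment of X.\<close>

lemma min_one_sum_le:
  fixes f :: "'i \<Rightarrow> real"
  assumes "finite I" "\<And>i. i \<in> I \<Longrightarrow> f i \<ge> 0"
  shows "min 1 (\<Sum>i\<in>I. f i) \<le> (\<Sum>i\<in>I. min 1 (f i))"
  using assms
proof (induction I)
  case (insert i I)
  then have "0 \<le> f i" "0 \<le> sum f I" "min 1 (sum f I) \<le> (\<Sum>i\<in>I. min 1 (f i))"
    by (auto intro: sum_nonneg)
  then show ?case using insert.hyps by (auto simp: min_def split: if_splits)
qed simp

lemma (in prob_space) ar_causal_representation:
  assumes p: "p \<ge> 1"
    and e: "\<And>t. integrable M (e t)" and m: "\<And>t. (\<integral>\<omega>. \<bar>e t \<omega>\<bar> \<partial>M) = m"
    and X: "ar_stationary_solution M p \<theta> e X"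
    and a: "summable (\<lambda>k. \<bar>ar_alpha p \<theta> k\<bar>)"
  shows "AE \<omega> in M. X t \<omega> = (\<Sum>k. ar_alpha p \<theta> k * e (t - int k) \<omega>)"
proof -
  let ?a = "ar_alpha p \<theta>" and ?c = "ar_remainder p \<theta>"
  have st: "strictly_stationary M X" using X by (simp add: ar_stationary_solution_def)
  have [measurable]: "X t \<in> borel_measurable M" for t
    using st by (simp add: strictly_stationary_def)
  have [measurable]: "e t \<in> borel_measurable M" for t using e by auto
  define R where "R n \<omega> = (\<Sum>i<p. ?c n i * X (t - int (n + i)) \<omega>)" for n \<omega>
  define Y where "Y \<omega> = (\<Sum>k. ?a k * e (t - int k) \<omega>)" for \<omega>
  have [measurable]: "Y \<in> borel_measurable M" "R n \<in> borel_measurable M" for n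
    unfolding Y_def R_def by measurable
  have "AE \<omega> in M. \<forall>u. X u \<omega> = (\<Sum>j=1..p. \<theta> j * X (u - int j) \<omega>) + e u \<omega>"
    using X by (simp add: ar_stationary_solution_def AE_all_countable)
  moreover have "AE \<omega> in M. summable (\<lambda>k. \<bar>?a k * e (t - int k) \<omega>\<bar>)"
    by (rule AE_summable_linear_series[OF e m a])
  ultimately have lim: "AE \<omega> in M. (\<lambda>n. R n \<omega>) \<longlonglongrightarrow> X t \<omega> - Y \<omega>"
  proof eventually_elim
    case (elim \<omega>)
    have "(\<Sum>k<n. ?a k * e (t - int k) \<omega>) + R n \<omega> = X t \<omega>" for n
    proof -
      have "e (t - int k) \<omega> = X (t - int k) \<omega> - (\<Sum>j=1..p. \<theta> j * X (t - int (k + j)) \<omega>)" for k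
        using elim(1)[rule_format, of "t - int k"] by (simp add: algebra_simps)
      then show ?thesis
        using ar_iterate[OF p, of \<theta> "\<lambda>k. X (t - int k) \<omega>" n] by (simp add: R_def)
    qed
    then have R: "R n \<omega> = X t \<omega> - (\<Sum>k<n. ?a k * e (t - int k) \<omega>)" for n
      by (simp add: algebra_simps)
    have "(\<lambda>n. \<Sum>k<n. ?a k * e (t - int k) \<omega>) \<longlonglongrightarrow> Y \<omega>"
      unfolding Y_def using summable_rabs_cancel[OF elim(2)] by (rule summable_LIMSEQ)
    then show ?case unfolding R by (intro tendsto_diff tendsto_const)
  qed
  have c0: "(\<lambda>n. ?c n i) \<longlonglongrightarrow> 0" for i
    using summable_LIMSEQ_zero[OF summable_rabs_cancel[OF a]] by (rule ar_remainder_tendsto_0)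
  have "(\<lambda>n. \<integral>\<omega>. min 1 \<bar>R n \<omega>\<bar> \<partial>M) \<longlonglongrightarrow> (\<integral>\<omega>. min 1 \<bar>X t \<omega> - Y \<omega>\<bar> \<partial>M)"
  proof (rule integral_dominated_convergence[where w="\<lambda>_. 1"])
    show "AE \<omega> in M. (\<lambda>n. min 1 \<bar>R n \<omega>\<bar>) \<longlonglongrightarrow> min 1 \<bar>X t \<omega> - Y \<omega>\<bar>"
      using lim by eventually_elim (intro tendsto_intros)
  qed auto
  \<comment> \<open>Stationarity replaces the moving variables X_{t-n-i} by the fixed
    \<open>X 0\<close>; dominated convergence then applies because the coefficients tend to
    0.\<close>
  moreover have "(\<lambda>n. \<integral>\<omega>. min 1 \<bar>R n \<omega>\<bar> \<partial>M) \<longlonglongrightarrow> 0"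
  proof (rule tendsto_sandwich[OF _ _ tendsto_const])
    have bdd: "integrable M (\<lambda>\<omega>. min 1 \<bar>f \<omega>\<bar>)" if "f \<in> borel_measurable M" for f :: "'a \<Rightarrow> real"
      using that by (intro integrable_const_bound[where B=1]) auto
    show "\<forall>\<^sub>F n in sequentially. (\<integral>\<omega>. min 1 \<bar>R n \<omega>\<bar> \<partial>M) \<le>
        (\<Sum>i<p. \<integral>\<omega>. min 1 \<bar>?c n i * X 0 \<omega>\<bar> \<partial>M)"
    proof (intro always_eventually allI)
      fix n
      have "(\<integral>\<omega>. min 1 \<bar>R n \<omega>\<bar> \<partial>M) \<le> (\<integral>\<omega>. (\<Sum>i<p. min 1 \<bar>?c n i * X (t - int (n + i)) \<omega>\<bar>) \<partial>M)"
      proof (rule integral_mono)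
        fix \<omega>
        have "min 1 \<bar>R n \<omega>\<bar> \<le> min 1 (\<Sum>i<p. \<bar>?c n i * X (t - int (n + i)) \<omega>\<bar>)"
          unfolding R_def by (intro min.mono sum_abs) simp
        also have "\<dots> \<le> (\<Sum>i<p. min 1 \<bar>?c n i * X (t - int (n + i)) \<omega>\<bar>)"
          by (rule min_one_sum_le) auto
        finally show "min 1 \<bar>R n \<omega>\<bar> \<le> \<dots>" .
      qed (auto intro!: bdd)
      also have "\<dots> = (\<Sum>i<p. \<integral>\<omega>. min 1 \<bar>?c n i * X (t - int (n + i)) \<omega>\<bar> \<partial>M)"
        by (rule Bochner_Integration.integral_sum) (auto intro!: bdd)
      also have "\<dots> = (\<Sum>i<p. \<integral>\<omega>. min 1 \<bar>?c n i * X 0 \<omega>\<bar> \<partial>M)"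
        by (intro sum.cong refl strictly_stationary_integral[OF st, of "\<lambda>x. min 1 \<bar>?c n _ * x\<bar>"]) auto
      finally show "(\<integral>\<omega>. min 1 \<bar>R n \<omega>\<bar> \<partial>M) \<le> \<dots>" .
    qed
    show "(\<lambda>n. \<Sum>i<p. \<integral>\<omega>. min 1 \<bar>?c n i * X 0 \<omega>\<bar> \<partial>M) \<longlonglongrightarrow> 0"
    proof (rule tendsto_null_sum)
      fix i
      have "(\<lambda>n. min 1 \<bar>?c n i * X 0 \<omega>\<bar>) \<longlonglongrightarrow> min 1 \<bar>0 * X 0 \<omega>\<bar>" for \<omega>
        by (intro tendsto_intros c0)
      then have "(\<lambda>n. \<integral>\<omega>. min 1 \<bar>?c n i * X 0 \<omega>\<bar> \<partial>M) \<longlonglongrightarrow> (\<integral>\<omega>. min 1 \<bar>0 * X 0 \<omega>\<bar> \<partial>M)"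
        by (intro integral_dominated_convergence[where w="\<lambda>_. 1"]) auto
      then show "(\<lambda>n. \<integral>\<omega>. min 1 \<bar>?c n i * X 0 \<omega>\<bar> \<partial>M) \<longlonglongrightarrow> 0" by simp
    qed
  qed auto
  ultimately have "(\<integral>\<omega>. min 1 \<bar>X t \<omega> - Y \<omega>\<bar> \<partial>M) = 0"
    by (rule LIMSEQ_unique)
  moreover have "integrable M (\<lambda>\<omega>. min 1 \<bar>X t \<omega> - Y \<omega>\<bar>)"
    by (intro integrable_const_bound[where B=1]) auto
  ultimately have "AE \<omega> in M. min 1 \<bar>X t \<omega> - Y \<omega>\<bar> = 0"
    by (subst (asm) integral_nonneg_eq_0_iff_AE) auto
  then show ?thesis
    by eventually_elim (auto simp: Y_def min_def split: if_splits)
qed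

section \<open>A covariance bound under independence\<close>

text \<open>Independence turns the covariance into an integral over a product law. For fixed
  \<open>b\<close>, the function \<open>H (a, b)\<close> differs from its mean over \<open>a\<close>
  by at most \<open>D a + d\<close>, where \<open>d\<close> is the mean of \<open>D\<close>;
  integrating this against \<open>\<bar>G\<bar> \<le> C\<close> gives
  \<open>C * (2 * d)\<close>.\<close>

lemma (in prob_space) abs_cov_le_of_indep:
  fixes G D :: "'b \<Rightarrow> real" and H :: "'b \<times> 'b \<Rightarrow> real"
  assumes ind: "indep_var S A T B"
    and [measurable]: "G \<in> borel_measurable S" and Gb: "\<And>a. a \<in> space S \<Longrightarrow> \<bar>G a\<bar> \<le> C"
    and [measurable]: "H \<in> borel_measurable (S \<Otimes>\<^sub>M T)" and H: "integrable M (\<lambda>\<omega>. H (A \<omega>, B \<omega>))"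
    and [measurable]: "D \<in> borel_measurable S" and D: "integrable M (\<lambda>\<omega>. D (A \<omega>))"
    and osc: "\<And>a a' b. a \<in> space S \<Longrightarrow> a' \<in> space S \<Longrightarrow> b \<in> space T \<Longrightarrow>
        \<bar>H (a, b) - H (a', b)\<bar> \<le> D a + D a'"
  shows "\<bar>cov M (\<lambda>\<omega>. G (A \<omega>)) (\<lambda>\<omega>. H (A \<omega>, B \<omega>))\<bar> \<le> C * (2 * (\<integral>\<omega>. D (A \<omega>) \<partial>M))"
proof -
  have [measurable]: "A \<in> measurable M S" "B \<in> measurable M T"
    using indep_var_rv1[OF ind] indep_var_rv2[OF ind] by auto
  define \<mu> where "\<mu> = distr M S A"
  define \<nu> where "\<nu> = distr M T B"
  interpret mu: prob_space \<mu> unfolding \<mu>_def by (rule prob_space_distr) simp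
  interpret nu: prob_space \<nu> unfolding \<nu>_def by (rule prob_space_distr) simp
  interpret P: pair_prob_space \<mu> \<nu> ..
  have sets[measurable_cong]: "sets \<mu> = sets S" "sets \<nu> = sets T"
    by (simp_all add: \<mu>_def \<nu>_def)
  have sp: "space \<mu> = space S" "space \<nu> = space T"
    by (simp_all add: \<mu>_def \<nu>_def)
  have joint: "\<mu> \<Otimes>\<^sub>M \<nu> = distr M (S \<Otimes>\<^sub>M T) (\<lambda>\<omega>. (A \<omega>, B \<omega>))"
    unfolding \<mu>_def \<nu>_def using ind indep_var_distribution_eq by blast
  define d where "d = (\<integral>a. D a \<partial>\<mu>)"
  have d: "d = (\<integral>\<omega>. D (A \<omega>) \<partial>M)" and Dint: "integrable \<mu> D"
    unfolding d_def \<mu>_def using D by (simp_all add: integral_distr integrable_distr_eq)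
  define m where "m = (\<integral>a. G a \<partial>\<mu>)"
  define w where "w = (\<integral>\<omega>. H (A \<omega>, B \<omega>) \<partial>M)"
  have m: "(\<integral>\<omega>. G (A \<omega>) \<partial>M) = m"
    unfolding m_def \<mu>_def by (simp add: integral_distr)
  have Gint: "integrable \<mu> G"
    by (rule mu.integrable_const_bound[of _ C]) (auto simp: sp Gb)
  have C0: "0 \<le> C"
  proof -
    obtain a where "a \<in> space S" using mu.not_empty sp by auto
    from Gb[OF this] show ?thesis by linarith
  qed
  have m_le: "\<bar>m\<bar> \<le> C"
  proof -
    have "\<bar>m\<bar> \<le> (\<integral>a. \<bar>G a\<bar> \<partial>\<mu>)" unfolding m_def by (rule integral_abs_bound)
    also have "\<dots> \<le> (\<integral>a. C \<partial>\<mu>)" using Gint by (intro integral_mono) (auto simp: sp Gb)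
    finally show ?thesis by (simp add: mu.prob_space)
  qed
  have Hint: "integrable (\<mu> \<Otimes>\<^sub>M \<nu>) H"
    unfolding joint using H by (simp add: integrable_distr_eq)
  let ?f = "\<lambda>a b. (G a - m) * (H (a, b) - w)"
  \<comment> \<open>Needed for Fubini: \<open>G\<close> and its mean are bounded by
    \<open>C\<close>, so the centred product is dominated by \<open>2 * C\<close> times the
    integrable \<open>\<bar>H - w\<bar>\<close>.\<close>
  have fint: "integrable (\<mu> \<Otimes>\<^sub>M \<nu>) (\<lambda>(a, b). ?f a b)"
  proof (rule Bochner_Integration.integrable_bound)
    show "integrable (\<mu> \<Otimes>\<^sub>M \<nu>) (\<lambda>x. (2 * C) * (H x - w))"
      using Hint by simp
    show "AE x in \<mu> \<Otimes>\<^sub>M \<nu>. norm (case x of (a, b) \<Rightarrow> ?f a b) \<le> norm ((2 * C) * (H x - w))"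
    proof (rule AE_I2)
      fix x assume "x \<in> space (\<mu> \<Otimes>\<^sub>M \<nu>)"
      then obtain a b where x: "x = (a, b)" "a \<in> space S" by (auto simp: space_pair_measure sp)
      have "\<bar>G a - m\<bar> \<le> 2 * C" using Gb[OF x(2)] m_le by linarith
      then show "norm (case x of (a, b) \<Rightarrow> ?f a b) \<le> norm ((2 * C) * (H x - w))"
        using C0 by (auto simp: x abs_mult intro!: mult_right_mono)
    qed
  qed simp
  have inner: "\<bar>\<integral>a. ?f a b \<partial>\<mu>\<bar> \<le> C * (2 * d)"
    if b: "b \<in> space T" and Hb: "integrable \<mu> (\<lambda>a. H (a, b))" for b
  proof -
    define v where "v = (\<integral>a. H (a, b) \<partial>\<mu>)"
    have GH: "integrable \<mu> (\<lambda>a. G a * H (a, b))"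
    proof (rule Bochner_Integration.integrable_bound)
      show "integrable \<mu> (\<lambda>a. C * H (a, b))" using Hb by simp
      show "AE a in \<mu>. norm (G a * H (a, b)) \<le> norm (C * H (a, b))"
        using C0 Gb by (auto simp: abs_mult sp intro!: mult_right_mono)
      show "(\<lambda>a. G a * H (a, b)) \<in> borel_measurable \<mu>" using b by measurable
    qed
    \<comment> \<open>The global mean \<open>w\<close> cancels because \<open>G - m\<close> has mean
      0, and the centring moves from \<open>G\<close> to \<open>H\<close>. Bounding \<open>G\<close>
      rather than \<open>G - m\<close> keeps the factor \<open>C\<close> instead of
      \<open>2 * C\<close>.\<close>
    have "(\<integral>a. ?f a b \<partial>\<mu>) = (\<integral>a. G a * H (a, b) - m * H (a, b) - w * G a + m * w \<partial>\<mu>)"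
      by (simp add: algebra_simps)
    also have "\<dots> = (\<integral>a. G a * H (a, b) \<partial>\<mu>) - m * v"
      using GH Hb Gint by (simp add: v_def m_def[symmetric] mu.prob_space)
    also have "\<dots> = (\<integral>a. G a * (H (a, b) - v) \<partial>\<mu>)"
      using GH Gint by (simp add: right_diff_distrib m_def)
    finally have "\<bar>\<integral>a. ?f a b \<partial>\<mu>\<bar> \<le> (\<integral>a. \<bar>G a * (H (a, b) - v)\<bar> \<partial>\<mu>)"
      by simp
    also have "\<dots> \<le> (\<integral>a. C * (D a + d) \<partial>\<mu>)"
    proof (rule integral_mono)
      have "integrable \<mu> (\<lambda>a. G a * (H (a, b) - v))"
        using GH Gint by (simp add: right_diff_distrib)
      then show "integrable \<mu> (\<lambda>a. \<bar>G a * (H (a, b) - v)\<bar>)" by (rule integrable_abs)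
      show "integrable \<mu> (\<lambda>a. C * (D a + d))" using Dint by simp
      fix a assume a: "a \<in> space \<mu>"
      \<comment> \<open>The section mean \<open>v\<close> is an average over an independent copy
        \<open>a'\<close> of \<open>a\<close>, so \<open>osc\<close> applies under the
        integral.\<close>
      have "H (a, b) - v = (\<integral>a'. H (a, b) - H (a', b) \<partial>\<mu>)"
        using Hb by (simp add: v_def mu.prob_space)
      then have "\<bar>H (a, b) - v\<bar> \<le> (\<integral>a'. \<bar>H (a, b) - H (a', b)\<bar> \<partial>\<mu>)"
        by simp
      also have "\<dots> \<le> (\<integral>a'. D a + D a' \<partial>\<mu>)"
        using Hb Dint a b osc by (intro integral_mono) (auto simp: sp)
      also have "\<dots> = D a + d" using Dint by (simp add: d_def mu.prob_space)
      finally show "\<bar>G a * (H (a, b) - v)\<bar> \<le> C * (D a + d)"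
        unfolding abs_mult using a C0 by (intro mult_mono) (auto simp: sp Gb)
    qed
    also have "\<dots> = C * (2 * d)"
      using Dint by (simp add: d_def mu.prob_space)
    finally show ?thesis .
  qed
  have "cov M (\<lambda>\<omega>. G (A \<omega>)) (\<lambda>\<omega>. H (A \<omega>, B \<omega>)) = (\<integral>x. (case x of (a, b) \<Rightarrow> ?f a b) \<partial>(\<mu> \<Otimes>\<^sub>M \<nu>))"
    unfolding joint cov_def m w_def[symmetric] by (subst integral_distr) auto
  also have "\<dots> = (\<integral>b. (\<integral>a. ?f a b \<partial>\<mu>) \<partial>\<nu>)"
    by (rule P.integral_snd[symmetric]) (rule fint)
  finally have "\<bar>cov M (\<lambda>\<omega>. G (A \<omega>)) (\<lambda>\<omega>. H (A \<omega>, B \<omega>))\<bar> \<le> (\<integral>b. \<bar>\<integral>a. ?f a b \<partial>\<mu>\<bar> \<partial>\<nu>)"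
    by simp
  also have "\<dots> \<le> (\<integral>b. C * (2 * d) \<partial>\<nu>)"
  proof (rule integral_mono_AE)
    show "integrable \<nu> (\<lambda>b. \<bar>\<integral>a. ?f a b \<partial>\<mu>\<bar>)"
      using P.integrable_snd[OF fint] by (rule integrable_abs)
    \<comment> \<open>Sections of \<open>H\<close> are integrable only for almost every
      \<open>b\<close>, which suffices for the outer integral.\<close>
    have "AE b in \<nu>. integrable \<mu> (\<lambda>a. H (a, b))"
      using P.AE_integrable_snd[of "\<lambda>a b. H (a, b)"] Hint by simp
    then show "AE b in \<nu>. \<bar>\<integral>a. ?f a b \<partial>\<mu>\<bar> \<le> C * (2 * d)"
      using AE_space by eventually_elim (auto simp: sp intro: inner)
  qed simp
  finally show ?thesis by (simp add: nu.prob_space d)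
qed

lemma cov_cong_AE:
  assumes "U \<in> borel_measurable M" "U' \<in> borel_measurable M"
    and "V \<in> borel_measurable M" "V' \<in> borel_measurable M"
    and "AE \<omega> in M. U \<omega> = U' \<omega>" "AE \<omega> in M. V \<omega> = V' \<omega>"
  shows "cov M U V = cov M U' V'"
proof -
  have "integral\<^sup>L M U = integral\<^sup>L M U'" "integral\<^sup>L M V = integral\<^sup>L M V'"
    using assms by (auto intro: integral_cong_AE)
  then show ?thesis
    unfolding cov_def using assms by (intro integral_cong_AE) auto
qed

lemma (in prob_space) cov_const_right: "cov M U (\<lambda>_. c) = 0"
  by (simp add: cov_def prob_space)

lemma cov_zero_left: "cov M (\<lambda>_. 0) V = 0"
  by (simp add: cov_def)

section \<open>The covariance bound for the autoregressive process\<close>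

lemma borel_measurable_comp_Rn:
  assumes "f \<in> borel_measurable (borel_Rn n)"
    and "\<And>i. i \<in> {1..n} \<Longrightarrow> Z i \<in> borel_measurable M"
  shows "(\<lambda>\<omega>. f (\<lambda>i\<in>{1..n}. Z i \<omega>)) \<in> borel_measurable M"
  using assms(2) by (intro measurable_compose[OF measurable_restrict assms(1)])

text \<open>The real-valued form of the result, with finite constants \<open>C\<close> and
  \<open>L\<close> in place of the sup norm and the Lipschitz constant. It applies
  \<open>abs_cov_le_of_indep\<close> to the noise up to time \<open>s k\<close> and the noise after
  it.\<close>

lemma (in prob_space) ar_abs_cov_le:
  fixes e X :: "int \<Rightarrow> 'a \<Rightarrow> real"
  assumes p: "p \<ge> 1"
    and ind: "indep_vars (\<lambda>_. borel) e UNIV"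
    and e: "\<And>t. integrable M (e t)" and m: "\<And>t. (\<integral>\<omega>. \<bar>e t \<omega>\<bar> \<partial>M) = m"
    and X: "ar_stationary_solution M p \<theta> e X"
    and r: "0 < r" "r < 1" and \<alpha>: "\<And>n. \<bar>ar_alpha p \<theta> n\<bar> \<le> K * r ^ n"
    and k: "k \<ge> 1" and s: "mono_on {1..k} s" and st: "s k \<le> t 1" and t: "mono_on {1..l} t"
    and g: "g \<in> borel_measurable (borel_Rn k)" and h: "h \<in> borel_measurable (borel_Rn l)"
    and C: "\<And>x. x \<in> Rn k \<Longrightarrow> \<bar>g x\<bar> \<le> C"
    and L: "0 \<le> L" "\<And>x y. x \<in> Rn l \<Longrightarrow> y \<in> Rn l \<Longrightarrow> \<bar>h x - h y\<bar> \<le> L * l1_norm l (\<lambda>i. x i - y i)"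
    and hX: "integrable M (\<lambda>\<omega>. h (\<lambda>i\<in>{1..l}. X (t i) \<omega>))"
  shows "\<bar>cov M (\<lambda>\<omega>. g (\<lambda>i\<in>{1..k}. X (s i) \<omega>)) (\<lambda>\<omega>. h (\<lambda>i\<in>{1..l}. X (t i) \<omega>))\<bar>
           \<le> C * L * (2 * (1 / (1 - r)) * K * m * real l * r powi (t 1 - s k))"
proof -
  let ?a = "ar_alpha p \<theta>"
  \<comment> \<open>The number of noise variables after time \<open>s k\<close> that enter X at time
    \<open>t i\<close>; it is 0, with \<open>Ft i\<close> an empty sum, when
    \<open>t i = s k\<close>.\<close>
  define n where "n i = nat (t i - s k)" for i
  define A where "A \<omega> = (\<lambda>j\<in>{..s k}. e j \<omega>)" for \<omega>
  define B where "B \<omega> = (\<lambda>j\<in>{s k<..}. e j \<omega>)" for \<omega>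
  define S where "S = (\<Pi>\<^sub>M j\<in>{..s k}. borel :: real measure)"
  define T where "T = (\<Pi>\<^sub>M j\<in>{s k<..}. borel :: real measure)"
  define Pt where "Pt i a = (\<Sum>q. ?a (q + n i) * a (s k - int q))" for i and a :: "int \<Rightarrow> real"
  define Ft where "Ft i b = (\<Sum>q<n i. ?a q * b (t i - int q))" for i and b :: "int \<Rightarrow> real"
  define G where "G a = g (\<lambda>i\<in>{1..k}. \<Sum>q. ?a q * a (s i - int q))" for a :: "int \<Rightarrow> real"
  define H where "H x = h (\<lambda>i\<in>{1..l}. Ft i (snd x) + Pt i (fst x))" for x :: "(int \<Rightarrow> real) \<times> (int \<Rightarrow> real)"
  define D where "D a = L * (\<Sum>i=1..l. \<bar>Pt i a\<bar>)" for a
  have [measurable]: "e j \<in> borel_measurable M" for j using e by auto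
  have [measurable]: "X j \<in> borel_measurable M" for j
    using X by (simp add: ar_stationary_solution_def strictly_stationary_def)
  have indAB: "indep_var S A T B"
    unfolding S_def T_def A_def B_def by (rule indep_var_restrict[OF ind]) auto
  have [measurable]: "A \<in> measurable M S" "B \<in> measurable M T"
    using indep_var_rv1[OF indAB] indep_var_rv2[OF indAB] by auto
  have s_le: "s i \<le> s k" if "i \<in> {1..k}" for i
    using that k by (intro mono_onD[OF s]) auto
  have t1_le: "t 1 \<le> t i" if "i \<in> {1..l}" for i
    using that by (intro mono_onD[OF t]) auto
  have n: "int (n i) = t i - s k" "n 1 \<le> n i" if "i \<in> {1..l}" for i
    using t1_le[OF that] st by (auto simp: n_def)
  have coordS: "(\<lambda>a. a (j - int q)) \<in> borel_measurable S" if "j \<le> s k" for j q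
    unfolding S_def using that by (intro measurable_component_singleton) auto
  have coordT: "(\<lambda>b. b (t i - int q)) \<in> borel_measurable T" if "i \<in> {1..l}" "q < n i" for i q
    unfolding T_def using that n[of i] by (intro measurable_component_singleton) auto
  have [measurable]: "Pt i \<in> borel_measurable S" for i
    unfolding Pt_def by (intro borel_measurable_suminf borel_measurable_times coordS) auto
  have Ft_meas: "Ft i \<in> borel_measurable T" if "i \<in> {1..l}" for i
    unfolding Ft_def using that by (intro borel_measurable_sum borel_measurable_times coordT) auto
  have [measurable]: "D \<in> borel_measurable S"
    unfolding D_def by measurable
  have Gm[measurable]: "G \<in> borel_measurable S"
    unfolding G_def
    by (intro borel_measurable_comp_Rn[OF g] borel_measurable_suminf borel_measurable_times
        coordS s_le borel_measurable_const)
  have Hm[measurable]: "H \<in> borel_measurable (S \<Otimes>\<^sub>M T)"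
    unfolding H_def
  proof (rule borel_measurable_comp_Rn[OF h])
    fix i assume "i \<in> {1..l}"
    note Ft_meas[OF this, measurable]
    show "(\<lambda>x. Ft i (snd x) + Pt i (fst x)) \<in> borel_measurable (S \<Otimes>\<^sub>M T)" by measurable
  qed
  have sum_geo: "summable (\<lambda>q. K * r ^ j * r ^ q)" for j
    using r by (intro summable_mult summable_geometric) auto
  have shift_le: "\<bar>?a (q + j)\<bar> \<le> K * r ^ j * r ^ q" for q j
    using \<alpha>[of "q + j"] by (simp add: power_add mult_ac)
  have summ: "summable (\<lambda>q. \<bar>?a (q + j)\<bar>)" for j
    by (rule summable_comparison_test'[OF sum_geo[of j]]) (use shift_le in auto)
  have summ0: "summable (\<lambda>q. \<bar>?a q\<bar>)" using summ[of 0] by simp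
  have tail_le: "(\<Sum>q. \<bar>?a (q + j)\<bar>) \<le> K * r ^ j / (1 - r)" for j
  proof -
    have "(\<Sum>q. \<bar>?a (q + j)\<bar>) \<le> (\<Sum>q. K * r ^ j * r ^ q)"
      by (intro suminf_le shift_le summ sum_geo)
    also have "\<dots> = K * r ^ j * (1 / (1 - r))"
      using r by (subst suminf_mult) (auto simp: suminf_geometric summable_geometric)
    finally show ?thesis by simp
  qed
  have m0: "0 \<le> m" unfolding m[of 0, symmetric] by simp
  have K0: "0 \<le> K" using \<alpha>[of 0] by simp
  have PtA: "Pt i (A \<omega>) = (\<Sum>q. ?a (q + n i) * e (s k - int q) \<omega>)" for i \<omega>
    by (simp add: Pt_def A_def)
  have Pt_int: "integrable M (\<lambda>\<omega>. Pt i (A \<omega>))" for i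
    unfolding PtA by (rule integrable_linear_series[OF e m summ])
  have Pt_le: "(\<integral>\<omega>. \<bar>Pt i (A \<omega>)\<bar> \<partial>M) \<le> K * r ^ n 1 / (1 - r) * m" if "i \<in> {1..l}" for i
  proof -
    have "(\<integral>\<omega>. \<bar>Pt i (A \<omega>)\<bar> \<partial>M) \<le> (\<Sum>q. \<bar>?a (q + n i)\<bar>) * m"
      unfolding PtA by (rule integral_abs_linear_series_le[OF e m summ])
    also have "\<dots> \<le> K * r ^ n i / (1 - r) * m"
      using m0 by (intro mult_right_mono tail_le)
    \<comment> \<open>Since \<open>t 1 \<le> t i\<close> and \<open>r < 1\<close>, the earliest time
      \<open>t 1\<close> gives the worst decay, uniformly in \<open>i\<close>.\<close>
    also have "\<dots> \<le> K * r ^ n 1 / (1 - r) * m"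
      using m0 K0 r n(2)[OF that]
      by (intro mult_right_mono divide_right_mono mult_left_mono power_decreasing) auto
    finally show ?thesis .
  qed
  have D_int: "integrable M (\<lambda>\<omega>. D (A \<omega>))"
    unfolding D_def using Pt_int by auto
  have D_le: "(\<integral>\<omega>. D (A \<omega>) \<partial>M) \<le> L * (real l * (K * r ^ n 1 / (1 - r) * m))"
  proof -
    have "(\<integral>\<omega>. D (A \<omega>) \<partial>M) = L * (\<Sum>i=1..l. \<integral>\<omega>. \<bar>Pt i (A \<omega>)\<bar> \<partial>M)"
      unfolding D_def using Pt_int by (simp add: Bochner_Integration.integral_sum)
    also have "\<dots> \<le> L * (\<Sum>i=1..l. K * r ^ n 1 / (1 - r) * m)"
      using L(1) by (intro mult_left_mono sum_mono Pt_le)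
    finally show ?thesis by simp
  qed
  \<comment> \<open>The integers are countable, so one null set serves all times.\<close>
  have AEX: "AE \<omega> in M. \<forall>j. X j \<omega> = (\<Sum>q. ?a q * e (j - int q) \<omega>)"
    unfolding AE_all_countable by (intro allI ar_causal_representation[OF p e m X summ0])
  have AEsum: "AE \<omega> in M. \<forall>j. summable (\<lambda>q. \<bar>?a q * e (j - int q) \<omega>\<bar>)"
    unfolding AE_all_countable by (intro allI AE_summable_linear_series[OF e m summ0])
  have AEg: "AE \<omega> in M. g (\<lambda>i\<in>{1..k}. X (s i) \<omega>) = G (A \<omega>)"
    using AEX
  proof eventually_elim
    case (elim \<omega>)
    have "A \<omega> (s i - int q) = e (s i - int q) \<omega>" if "i \<in> {1..k}" for i q
      using s_le[OF that] by (auto simp: A_def)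
    then show ?case
      unfolding G_def using elim by (intro arg_cong[where f=g] restrict_ext) simp
  qed
  have AEh: "AE \<omega> in M. h (\<lambda>i\<in>{1..l}. X (t i) \<omega>) = H (A \<omega>, B \<omega>)"
    using AEX AEsum
  proof eventually_elim
    case (elim \<omega>)
    have "X (t i) \<omega> = Ft i (B \<omega>) + Pt i (A \<omega>)" if i: "i \<in> {1..l}" for i
    proof -
      have "Ft i (B \<omega>) = (\<Sum>q<n i. ?a q * e (t i - int q) \<omega>)"
        unfolding Ft_def using n(1)[OF i] by (intro sum.cong) (auto simp: B_def)
      \<comment> \<open>Splitting the causal series at \<open>q = n i\<close> makes the tail start
        at noise time \<open>s k\<close>, matching the indexing in \<open>Pt\<close>.\<close>
      moreover have "t i - int (q + n i) = s k - int q" for q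
        using n(1)[OF i] by simp
      then have "Pt i (A \<omega>) = (\<Sum>q. ?a (q + n i) * e (t i - int (q + n i)) \<omega>)"
        unfolding PtA by presburger
      ultimately show ?thesis
        using elim suminf_split_initial_segment[OF summable_rabs_cancel, of "\<lambda>q. ?a q * e (t i - int q) \<omega>" "n i"]
        by simp
    qed
    then show ?case
      unfolding H_def by (intro arg_cong[where f=h] restrict_ext) simp
  qed
  have gX_meas: "(\<lambda>\<omega>. g (\<lambda>i\<in>{1..k}. X (s i) \<omega>)) \<in> borel_measurable M"
    by (rule borel_measurable_comp_Rn[OF g]) simp
  have hX_meas: "(\<lambda>\<omega>. h (\<lambda>i\<in>{1..l}. X (t i) \<omega>)) \<in> borel_measurable M"
    by (rule borel_measurable_comp_Rn[OF h]) simp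
  have HAB: "integrable M (\<lambda>\<omega>. H (A \<omega>, B \<omega>))"
    by (rule integrable_cong_AE_imp[OF hX _ AEh]) measurable
  \<comment> \<open>Valid for every \<open>a\<close>, also where the series in \<open>G\<close>
    diverges: the restricted argument of \<open>g\<close> is always a point of
    \<open>Rn k\<close>.\<close>
  have G_le: "\<bar>G a\<bar> \<le> C" for a
    unfolding G_def by (rule C) auto
  have osc: "\<bar>H (a, b) - H (a', b)\<bar> \<le> D a + D a'" for a a' b
  proof -
    \<comment> \<open>The future parts \<open>Ft i b\<close> cancel in the difference of the
      arguments.\<close>
    have "\<bar>H (a, b) - H (a', b)\<bar> \<le> L * (\<Sum>i=1..l. \<bar>Pt i a - Pt i a'\<bar>)"
      unfolding H_def by (rule order_trans[OF L(2)]) (auto simp: l1_norm_def intro!: mult_left_mono L(1) sum_mono)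
    also have "\<dots> \<le> L * (\<Sum>i=1..l. \<bar>Pt i a\<bar> + \<bar>Pt i a'\<bar>)"
      using L(1) by (intro mult_left_mono sum_mono abs_triangle_ineq4)
    finally show ?thesis by (simp add: D_def sum.distrib distrib_left)
  qed
  have C0: "0 \<le> C" using G_le[of "\<lambda>_. 0"] by linarith
  have "cov M (\<lambda>\<omega>. g (\<lambda>i\<in>{1..k}. X (s i) \<omega>)) (\<lambda>\<omega>. h (\<lambda>i\<in>{1..l}. X (t i) \<omega>)) =
      cov M (\<lambda>\<omega>. G (A \<omega>)) (\<lambda>\<omega>. H (A \<omega>, B \<omega>))"
    by (intro cov_cong_AE gX_meas hX_meas AEg AEh) measurable
  then have "\<bar>cov M (\<lambda>\<omega>. g (\<lambda>i\<in>{1..k}. X (s i) \<omega>)) (\<lambda>\<omega>. h (\<lambda>i\<in>{1..l}. X (t i) \<omega>))\<bar> \<le>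
      C * (2 * (\<integral>\<omega>. D (A \<omega>) \<partial>M))"
    using abs_cov_le_of_indep[OF indAB Gm G_le Hm HAB _ D_int osc] by simp
  also have "\<dots> \<le> C * (2 * (L * (real l * (K * r ^ n 1 / (1 - r) * m))))"
    using C0 D_le by (intro mult_left_mono) auto
  also have "r ^ n 1 = r powi (t 1 - s k)"
    using st by (simp add: n_def power_int_def)
  finally show ?thesis by (simp add: mult_ac del: restrict_apply restrict_apply')
qed

section \<open>Root modulus, extended-real norms and the final estimate\<close>

text \<open>Because \<open>\<theta> p \<noteq> 0\<close>, the polynomial is nonconstant and has a
  root. The \<open>Min\<close> is thus over a finite nonempty set and is attained, at a root outside
  the closed unit disc.\<close>

lemma ar_rho_pos:
  assumes "p \<ge> 1" "\<theta> p \<noteq> 0" "\<And>z. cmod z \<le> 1 \<Longrightarrow> poly (ar_poly p \<theta>) z \<noteq> 0"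
  shows "ar_rho p \<theta> > 0"
proof -
  have "coeff (ar_poly p \<theta>) p = - (\<Sum>j=1..p. if j = p then complex_of_real (\<theta> j) else 0)"
    using assms(1) by (simp add: ar_poly_def coeff_sum)
  also have "\<dots> = - complex_of_real (\<theta> p)"
    using assms(1) by (simp add: sum.delta)
  finally have c: "coeff (ar_poly p \<theta>) p \<noteq> 0" using assms(2) by simp
  then have nz: "ar_poly p \<theta> \<noteq> 0" by auto
  have "degree (ar_poly p \<theta>) > 0"
    using le_degree[OF c] assms(1) by simp
  then have "\<exists>z. poly (ar_poly p \<theta>) z = 0"
    by (intro fundamental_theorem_of_algebra) (simp add: constant_degree)
  moreover have "finite {z. poly (ar_poly p \<theta>) z = 0}"
    by (rule poly_roots_finite[OF nz])
  ultimately have "ar_rho p \<theta> \<in> cmod ` {z. poly (ar_poly p \<theta>) z = 0}"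
    unfolding ar_rho_def by (intro Min_in) auto
  then obtain z where "ar_rho p \<theta> = cmod z" "poly (ar_poly p \<theta>) z = 0"
    by auto
  with assms(3)[of z] show ?thesis by fastforce
qed

lemma abs_le_sup_norm:
  assumes "sup_norm n g = ennreal C" "0 \<le> C" "x \<in> Rn n"
  shows "\<bar>g x\<bar> \<le> C"
proof -
  have "ennreal \<bar>g x\<bar> \<le> sup_norm n g"
    unfolding sup_norm_def using assms(3) by (rule SUP_upper)
  then show ?thesis using assms by (simp add: ennreal_le_iff)
qed

text \<open>Distinct extensional functions differ at some index in \<open>{1..n}\<close>, so the
  denominator in \<open>Lip\<close> is positive and can be cleared.\<close>

lemma abs_diff_le_Lip:
  assumes "Lip n h = ennreal L" "0 \<le> L" "x \<in> Rn n" "y \<in> Rn n"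
  shows "\<bar>h x - h y\<bar> \<le> L * l1_norm n (\<lambda>i. x i - y i)"
proof (cases "x = y")
  case False
  then obtain i where "i \<in> {1..n}" "x i \<noteq> y i"
    using assms(3,4) PiE_ext by metis
  then have pos: "l1_norm n (\<lambda>i. x i - y i) > 0"
    unfolding l1_norm_def by (intro sum_pos2[of _ i]) auto
  have "ennreal (\<bar>h x - h y\<bar> / l1_norm n (\<lambda>i. x i - y i)) \<le> Lip n h"
    unfolding Lip_def by (rule SUP_upper2[of "(x, y)"]) (use False assms in auto)
  then show ?thesis using assms(1,2) pos by (simp add: ennreal_le_iff pos_divide_le_eq)
qed (use assms in \<open>simp add: l1_norm_def\<close>)

theorem corollary2p1:
  fixes M :: "'a measure"
    and p k l :: nat
    and \<theta> :: "nat \<Rightarrow> real"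
    and e X :: "int \<Rightarrow> 'a \<Rightarrow> real"
    and \<epsilon> \<rho>\<^sub>\<epsilon> K\<^sub>\<epsilon> K\<^sub>1 :: real
    and s t :: "nat \<Rightarrow> int"
    and g h :: "(nat \<Rightarrow> real) \<Rightarrow> real"
  assumes "prob_space M"
    and "p \<ge> 1" and "\<theta> p \<noteq> 0"
    and "\<And>z. cmod z \<le> 1 \<Longrightarrow> poly (ar_poly p \<theta>) z \<noteq> 0"
    and "iid M e"
    and "\<And>t. integrable M (e t)" and "\<And>t. (\<integral>\<omega>. e t \<omega> \<partial>M) = 0"
    and "ar_stationary_solution M p \<theta> e X"
    and "\<epsilon> > 0"
    and "\<rho>\<^sub>\<epsilon> = (1 + \<epsilon>) / ar_rho p \<theta>" and "\<rho>\<^sub>\<epsilon> < 1"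
    and "\<And>n. \<bar>ar_alpha p \<theta> n\<bar> \<le> K\<^sub>\<epsilon> * \<rho>\<^sub>\<epsilon> ^ n"
    and "k \<ge> 1" and "l \<ge> 1"
    and "mono_on {1..k} s" and "s k \<le> t 1" and "mono_on {1..l} t"
    and "g \<in> borel_measurable (borel_Rn k)"
    and "h \<in> borel_measurable (borel_Rn l)"
    and "bounded (g ` Rn k)"
    and "integrable M (\<lambda>\<omega>. h (\<lambda>i\<in>{1..l}. X (t i) \<omega>))"
    and "K\<^sub>1 = 2 * (1 / (1 - \<rho>\<^sub>\<epsilon>)) * K\<^sub>\<epsilon> * (\<integral>\<omega>. \<bar>e 0 \<omega>\<bar> \<partial>M)"
  shows "ennreal \<bar>cov M (\<lambda>\<omega>. g (\<lambda>i\<in>{1..k}. X (s i) \<omega>)) (\<lambda>\<omega>. h (\<lambda>i\<in>{1..l}. X (t i) \<omega>))\<bar>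
           \<le> sup_norm k g * Lip l h * ennreal (K\<^sub>1 * real l * \<rho>\<^sub>\<epsilon> powi (t 1 - s k))"
proof -
  interpret prob_space M by fact
  have ind: "indep_vars (\<lambda>_. borel) e UNIV" and law: "\<And>t. distr M borel (e t) = distr M borel (e 0)"
    using \<open>iid M e\<close> by (auto simp: iid_def)
  note e = \<open>\<And>t. integrable M (e t)\<close>
  have [measurable]: "e t \<in> borel_measurable M" for t using e by auto
  define m where "m = (\<integral>\<omega>. \<bar>e 0 \<omega>\<bar> \<partial>M)"
  have m: "(\<integral>\<omega>. \<bar>e t \<omega>\<bar> \<partial>M) = m" for t
    using integral_distr[of "e t" M borel "\<lambda>x. \<bar>x\<bar>"] integral_distr[of "e 0" M borel "\<lambda>x. \<bar>x\<bar>"] law[of t]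
    by (simp add: m_def)
  note X = \<open>ar_stationary_solution M p \<theta> e X\<close>
  have [measurable]: "X j \<in> borel_measurable M" for j
    using X by (simp add: ar_stationary_solution_def strictly_stationary_def)
  note al = \<open>\<And>n. \<bar>ar_alpha p \<theta> n\<bar> \<le> K\<^sub>\<epsilon> * \<rho>\<^sub>\<epsilon> ^ n\<close>
  have r: "0 < \<rho>\<^sub>\<epsilon>" "\<rho>\<^sub>\<epsilon> < 1"
    using ar_rho_pos[of p \<theta>] assms by auto
  \<comment> \<open>From alpha_0 = 1; this makes the constant \<open>c\<close> strictly positive in
    the last case below.\<close>
  have K: "K\<^sub>\<epsilon> \<ge> 1"
    using al[of 0] ar_alpha_rec[of p \<theta> 0] by (auto simp: sum.neutral)
  have m0: "m \<ge> 0" by (simp add: m_def)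
  define c where "c = K\<^sub>1 * real l * \<rho>\<^sub>\<epsilon> powi (t 1 - s k)"
  have c_eq: "c = 2 * (1 / (1 - \<rho>\<^sub>\<epsilon>)) * K\<^sub>\<epsilon> * m * real l * \<rho>\<^sub>\<epsilon> powi (t 1 - s k)"
    unfolding c_def m_def using assms by simp
  define gX where "gX = (\<lambda>\<omega>. g (\<lambda>i\<in>{1..k}. X (s i) \<omega>))"
  define hX where "hX = (\<lambda>\<omega>. h (\<lambda>i\<in>{1..l}. X (t i) \<omega>))"
  have gX_meas: "gX \<in> borel_measurable M"
    unfolding gX_def using assms by (intro borel_measurable_comp_Rn) auto
  have hX_meas: "hX \<in> borel_measurable M"
    unfolding hX_def using assms by (intro borel_measurable_comp_Rn) auto
  have sup_fin: "sup_norm k g \<noteq> \<infinity>"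
  proof -
    obtain C where "\<And>x. x \<in> Rn k \<Longrightarrow> \<bar>g x\<bar> \<le> C"
      using \<open>bounded (g ` Rn k)\<close> by (auto simp: bounded_iff)
    then have "sup_norm k g \<le> ennreal C"
      unfolding sup_norm_def by (intro SUP_least ennreal_leI)
    then show ?thesis by (auto simp: top_unique)
  qed
  then obtain C where C: "sup_norm k g = ennreal C" "0 \<le> C"
    by (cases "sup_norm k g") auto
  have "ennreal \<bar>cov M gX hX\<bar> \<le> sup_norm k g * Lip l h * ennreal c"
  proof (cases "Lip l h")
    case (real L)
    have "\<bar>cov M gX hX\<bar> \<le> C * L * c"
      unfolding c_eq gX_def hX_def
      by (rule ar_abs_cov_le[OF \<open>p \<ge> 1\<close> ind e m X r al]) (use assms real C in \<open>auto simp del: restrict_apply One_nat_def intro: abs_le_sup_norm abs_diff_le_Lip\<close>)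
    then have "ennreal \<bar>cov M gX hX\<bar> \<le> ennreal (C * L * c)"
      by (rule ennreal_leI)
    then show ?thesis using real C by (simp add: ennreal_mult')
  next
    case top
    \<comment> \<open>In \<open>ennreal\<close>, \<open>0 * \<infinity> = 0\<close>: if \<open>g = 0\<close> or the noise vanishes, the covariance must be \<open>0\<close>.\<close>
    consider "C = 0" | "m = 0" | "C > 0" "m > 0"
      using C m0 by linarith
    then show ?thesis
    proof cases
      case 1
      have "g x = 0" if "x \<in> Rn k" for x
        using abs_le_sup_norm[OF C that] 1 by simp
      then have "gX = (\<lambda>_. 0)"
        unfolding gX_def by (intro ext) auto
      then show ?thesis by (simp add: cov_zero_left)
    next
      case 2
      \<comment> \<open>If \<open>m = 0\<close>, all noise vanishes almost surely. By the causal
        representation so does X, hence \<open>hX\<close> is almost surely constant.\<close>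
      have "AE \<omega> in M. \<forall>j. e j \<omega> = 0"
      proof (subst AE_all_countable, intro allI)
        fix j
        show "AE \<omega> in M. e j \<omega> = 0"
          using m[of j] 2 integral_nonneg_eq_0_iff_AE[of M "\<lambda>\<omega>. \<bar>e j \<omega>\<bar>"] e by simp
      qed
      moreover have "summable (\<lambda>q. \<bar>ar_alpha p \<theta> q\<bar>)"
        by (rule summable_comparison_test'[of "\<lambda>q. K\<^sub>\<epsilon> * \<rho>\<^sub>\<epsilon> ^ q"])
          (use r al in \<open>auto intro!: summable_mult summable_geometric\<close>)
      then have "AE \<omega> in M. \<forall>j. X j \<omega> = (\<Sum>q. ar_alpha p \<theta> q * e (j - int q) \<omega>)"
        unfolding AE_all_countable by (intro allI ar_causal_representation[OF \<open>p \<ge> 1\<close> e m X])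
      ultimately have "AE \<omega> in M. hX \<omega> = h (\<lambda>i\<in>{1..l}. 0)"
        by eventually_elim (simp add: hX_def)
      then have "cov M gX hX = cov M gX (\<lambda>_. h (\<lambda>i\<in>{1..l}. 0))"
        by (intro cov_cong_AE gX_meas hX_meas) auto
      then show ?thesis by (simp add: cov_const_right)
    next
      case 3
      \<comment> \<open>With \<open>C\<close>, \<open>c\<close> positive and the Lipschitz constant
        infinite, the right-hand side is infinite.\<close>
      have "c > 0"
        unfolding c_eq using 3 r K \<open>l \<ge> 1\<close> by (intro mult_pos_pos) auto
      then show ?thesis using top C 3 by (simp add: ennreal_mult_top ennreal_top_mult)
    qed
  qed
  then show ?thesis by (simp add: gX_def hX_def c_def)
qed

end
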